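(* The Vaidya-Bonner-de Sitter spacetime is neither an Einstein manifold nor a quasi-Einstein manifold, but (i) it is $2$-quasi-Einstein, as $\mathrm{rank}(S-\varphi g)=2$ for $\varphi=\frac{r^4\lambda+q^2}{r^4}$; (ii) the common (general) form of a $(0,2)$ tensor compatible with $R$ is, in the coordinates $(t,r,\theta,\phi)$, $$\begin{pmatrix}\mathcal H_{11}&\mathcal H_{12}&0&0\\ \mathcal H_{12}-\frac{3r\mathcal H_{22}(2rm'-(q^2)')}{2\lambda_2}&\mathcal H_{22}&0&0\\ 0&0&\mathcal H_{33}&\mathcal H_{34}\\ 0&0&\mathcal H_{34}&\mathcal H_{44}\end{pmatrix},$$ where $\lambda_2=r^4\lambda-3rm+3q^2$ and $\mathcal H_{ij}$ are arbitrary scalars.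
   Context: The Vaidya-Bonner-de Sitter (VBdS) spacetime is the $4$-dimensional Lorentzian manifold with coordinates $(x^1,x^2,x^3,x^4)=(t,r,\theta,\phi)$ and metric $ds^2=\left(1-\frac{2m(t)}{r}+\frac{q^2(t)}{r^2}-\frac{\lambda r^2}{3}\right)dt^2-2\,dt\,dr-r^2(d\theta^2+\sin^2\theta\, d\phi^2)$, where $\lambda$ is a constant and the mass $m=m(t)$ and charge $q=q(t)$ are smooth functions depending on $t$; $m'=\frac{dm}{dt}$ and $(q^2)'=\frac{d(q^2)}{dt}$. Curvature conventions: $R_{efst}=g_{e\alpha}(\partial_s\Gamma^\alpha_{ft}-\partial_t\Gamma^\alpha_{fs}+\Gamma^\beta_{ft}\Gamma^\alpha_{\beta s}-\Gamma^\beta_{fs}\Gamma^\alpha_{\beta t})$, Ricci tensor $S_{fs}=g^{et}R_{efst}$. A semi-Riemannian manifold is Einstein, quasi-Einstein or $2$-quasi-Einstein if, for some scalar $\varphi$, the rank of $S-\varphi g$ is $0$, $1$ or $2$ respectively. A $(0,2)$ tensor $H$ is compatible with a $(0,4)$ tensor $D$ if the cyclic sum over $e,f,s$ of $H_e{}^d D_{fstd}$ vanishes, with $H_e{}^d=g^{d\alpha}H_{e\alpha}$.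
   Formalization: The charge q(t) is assumed nowhere zero: where q=0 the rank of S−φg for the stated φ is at most 1, and q=m=0 gives an Einstein manifold. Part (ii) is stated where λ₂≠0, since the formula divides by λ₂, and for continuous tensor fields. *)

theory Defs
  imports "HOL-Analysis.Analysis"
begin

section \<open>Coordinate tensor calculus\<close>

text \<open>
  A metric or a (0,2) tensor field in a fixed coordinate chart is a matrix-valued function of the
  coordinates. A (0,4) tensor at a point is a function of four indices.
\<close>

definition partial_deriv :: "'n::finite \<Rightarrow> (real^'n \<Rightarrow> real) \<Rightarrow> real^'n \<Rightarrow> real" where
  "partial_deriv i f x = deriv (\<lambda>s. f (x + s *\<^sub>R axis i 1)) 0"

text \<open>\<open>christoffel g a b c x\<close> is \<open>\<Gamma>\<close> with upper index \<open>a\<close> and lower indices \<open>b\<close>, \<open>c\<close>.\<close>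

definition christoffel ::
  "(real^'n \<Rightarrow> real^'n^'n) \<Rightarrow> 'n::finite \<Rightarrow> 'n \<Rightarrow> 'n \<Rightarrow> real^'n \<Rightarrow> real" where
  "christoffel g a b c x =
     (1/2) * (\<Sum>d\<in>UNIV. matrix_inv (g x) $ a $ d *
        (partial_deriv b (\<lambda>y. g y $ d $ c) x
         + partial_deriv c (\<lambda>y. g y $ b $ d) x
         - partial_deriv d (\<lambda>y. g y $ b $ c) x))"

definition riemann ::
  "(real^'n \<Rightarrow> real^'n^'n) \<Rightarrow> real^'n \<Rightarrow> 'n::finite \<Rightarrow> 'n \<Rightarrow> 'n \<Rightarrow> 'n \<Rightarrow> real" where
  "riemann g x e f s t =
     (\<Sum>a\<in>UNIV. g x $ e $ a *
        (partial_deriv s (christoffel g a f t) x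
         - partial_deriv t (christoffel g a f s) x
         + (\<Sum>b\<in>UNIV. christoffel g b f t x * christoffel g a b s x)
         - (\<Sum>b\<in>UNIV. christoffel g b f s x * christoffel g a b t x)))"

text \<open>
  The first index is contracted with the last one, so this is the negative of the Ricci tensor
  obtained by contracting the first index with the third.
\<close>

definition ricci ::
  "(real^'n \<Rightarrow> real^'n^'n) \<Rightarrow> real^'n \<Rightarrow> real^'n^'n::finite" where
  "ricci g x =
     (\<chi> f s. \<Sum>e\<in>UNIV. \<Sum>t\<in>UNIV. matrix_inv (g x) $ e $ t * riemann g x e f s t)"

definition einstein_on ::
  "(real^'n) set \<Rightarrow> (real^'n \<Rightarrow> real^'n^'n::finite) \<Rightarrow> bool" where
  "einstein_on M g \<longleftrightarrow>
     (\<exists>\<phi> :: real^'n \<Rightarrow> real. \<forall>x\<in>M. rank (ricci g x - \<phi> x *\<^sub>R g x) = 0)"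

definition quasi_einstein_on ::
  "(real^'n) set \<Rightarrow> (real^'n \<Rightarrow> real^'n^'n::finite) \<Rightarrow> bool" where
  "quasi_einstein_on M g \<longleftrightarrow>
     (\<exists>\<phi> :: real^'n \<Rightarrow> real. \<forall>x\<in>M. rank (ricci g x - \<phi> x *\<^sub>R g x) = 1)"

definition two_quasi_einstein_on ::
  "(real^'n) set \<Rightarrow> (real^'n \<Rightarrow> real^'n^'n::finite) \<Rightarrow> bool" where
  "two_quasi_einstein_on M g \<longleftrightarrow>
     (\<exists>\<phi> :: real^'n \<Rightarrow> real. \<forall>x\<in>M. rank (ricci g x - \<phi> x *\<^sub>R g x) = 2)"

text \<open>\<open>raise_second G H e d\<close> is \<open>H\<close> with second index raised by the metric matrix \<open>G\<close> at a point.\<close>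

definition raise_second ::
  "real^'n^'n \<Rightarrow> real^'n^'n \<Rightarrow> 'n::finite \<Rightarrow> 'n \<Rightarrow> real" where
  "raise_second G H e d = (\<Sum>a\<in>UNIV. matrix_inv G $ d $ a * H $ e $ a)"

definition compatible ::
  "real^'n^'n \<Rightarrow> real^'n^'n \<Rightarrow> ('n::finite \<Rightarrow> 'n \<Rightarrow> 'n \<Rightarrow> 'n \<Rightarrow> real) \<Rightarrow> bool" where
  "compatible G H D \<longleftrightarrow>
     (\<forall>e f s t.
        (\<Sum>d\<in>UNIV. raise_second G H e d * D f s t d)
      + (\<Sum>d\<in>UNIV. raise_second G H f d * D s e t d)
      + (\<Sum>d\<in>UNIV. raise_second G H s d * D e f t d) = 0)"

section \<open>The Vaidya-Bonner-de Sitter spacetime\<close>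

definition smooth_real_on :: "real set \<Rightarrow> (real \<Rightarrow> real) \<Rightarrow> bool" where
  "smooth_real_on T f \<longleftrightarrow> (\<forall>k. \<forall>t\<in>T. ((deriv ^^ k) f) differentiable (at t))"

text \<open>
  The coordinates \<open>(t, r, \<theta>, \<phi>)\<close> are \<open>(x$1, x$2, x$3, x$4)\<close>. The time coordinate ranges over a
  set \<open>T\<close>, later an open interval on which the mass and charge functions are smooth.
\<close>

definition vbds_domain :: "real set \<Rightarrow> (real^4) set" where
  "vbds_domain T =
     {x. x$1 \<in> T \<and> 0 < x$2 \<and> 0 < x$3 \<and> x$3 < pi \<and> 0 < x$4 \<and> x$4 < 2 * pi}"

definition vbds_metric :: "(real \<Rightarrow> real) \<Rightarrow> (real \<Rightarrow> real) \<Rightarrow> real \<Rightarrow> real^4 \<Rightarrow> real^4^4" where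
  "vbds_metric m q \<Lambda> x =
     (let t = x$1; r = x$2; \<theta> = x$3 in
      vector [vector [1 - 2 * m t / r + (q t)\<^sup>2 / r\<^sup>2 - \<Lambda> * r\<^sup>2 / 3, -1, 0, 0],
              vector [-1, 0, 0, 0],
              vector [0, 0, - r\<^sup>2, 0],
              vector [0, 0, 0, - (r\<^sup>2 * (sin \<theta>)\<^sup>2)]])"

definition vbds_lambda2 :: "(real \<Rightarrow> real) \<Rightarrow> (real \<Rightarrow> real) \<Rightarrow> real \<Rightarrow> real^4 \<Rightarrow> real" where
  "vbds_lambda2 m q \<Lambda> x =
     (let t = x$1; r = x$2 in r^4 * \<Lambda> - 3 * r * m t + 3 * (q t)\<^sup>2)"

definition vbds_compatible_form ::
  "(real \<Rightarrow> real) \<Rightarrow> (real \<Rightarrow> real) \<Rightarrow> real \<Rightarrow> real^4 \<Rightarrow>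
   real \<Rightarrow> real \<Rightarrow> real \<Rightarrow> real \<Rightarrow> real \<Rightarrow> real \<Rightarrow> real^4^4" where
  "vbds_compatible_form m q \<Lambda> x h11 h12 h22 h33 h34 h44 =
     (let t = x$1; r = x$2 in
      vector [vector [h11, h12, 0, 0],
              vector [h12 - 3 * r * h22 * (2 * r * deriv m t - deriv (\<lambda>s. (q s)\<^sup>2) t)
                              / (2 * vbds_lambda2 m q \<Lambda> x), h22, 0, 0],
              vector [0, 0, h33, h34],
              vector [0, 0, h34, h44]])"

text \<open>The part of the domain on which the entries of the matrix above are defined.\<close>

definition vbds_regular :: "real set \<Rightarrow> (real \<Rightarrow> real) \<Rightarrow> (real \<Rightarrow> real) \<Rightarrow> real \<Rightarrow> (real^4) set" where
  "vbds_regular T m q \<Lambda> = {x \<in> vbds_domain T. vbds_lambda2 m q \<Lambda> x \<noteq> 0}"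

end

theory Submission
  imports Defs
begin

text \<open>
  The metric has the shape \<open>F dt\<^sup>2 - 2 dt dr - r\<^sup>2 d\<Omega>\<^sup>2\<close>, and for a general \<open>F(t,r)\<close> the curvature
  is governed by the four quantities \<open>F\<^sub>r\<^sub>r\<close>, \<open>F\<^sub>t - F F\<^sub>r\<close>, \<open>F\<^sub>r\<close> and \<open>1 - F\<close>. In \<open>S - \<phi> g\<close> the
  \<open>(t,r)\<close> block and the angular block are invertible unless \<open>\<phi> = \<Lambda> - q\<^sup>2/r\<^sup>4\<close>, respectively
  \<open>\<phi> = \<Lambda> + q\<^sup>2/r\<^sup>4\<close>; as \<open>q \<noteq> 0\<close>, at least one of them is invertible, so the rank is at least \<open>2\<close>, and
  the second choice makes the angular block vanish. Compatibility of \<open>H\<close> splits into the relations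
  \<open>F\<^sub>r (H\<^sub>1\<^sub>2 - H\<^sub>2\<^sub>1) = F\<^sub>t H\<^sub>2\<^sub>2\<close> and \<open>F\<^sub>r (H\<^sub>3\<^sub>4 - H\<^sub>4\<^sub>3) = 0\<close>, where \<open>F\<^sub>r\<close> is a nonzero multiple of
  \<open>\<lambda>\<^sub>2\<close>, and linear systems for the mixed entries with determinant \<open>F\<^sub>r\<^sup>2 + 2 F\<^sub>r\<^sub>r (1 - F)\<close>. The determinant
  may vanish at some points, but for fixed \<open>t\<close> only at finitely many \<open>r\<close>, so continuity of \<open>H\<close> forces the
  mixed entries to vanish everywhere.
\<close>

section \<open>Matrices and partial derivatives\<close>

lemma vector_4 [simp]:
  "(vector [w, x, y, z] :: 'a::zero^4) $ 1 = w"
  "(vector [w, x, y, z] :: 'a::zero^4) $ 2 = x"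
  "(vector [w, x, y, z] :: 'a::zero^4) $ 3 = y"
  "(vector [w, x, y, z] :: 'a::zero^4) $ 4 = z"
  unfolding vector_def by simp_all

lemma matrix_inv_eqI:
  fixes A :: "real^'n^'n"
  assumes "A ** B = mat 1" and "B ** A = mat 1"
  shows "matrix_inv A = B"
proof -
  have "A ** matrix_inv A = mat 1 \<and> matrix_inv A ** A = mat 1"
    unfolding matrix_inv_def by (rule someI[where x = B]) (use assms in blast)
  then show ?thesis
    using assms by (metis matrix_mul_assoc matrix_mul_lid matrix_mul_rid)
qed

lemma partial_deriv_eqI:
  "((\<lambda>s. f (x + s *\<^sub>R axis i 1)) has_real_derivative D) (at 0) \<Longrightarrow> partial_deriv i f x = D"
  unfolding partial_deriv_def by (rule DERIV_imp_deriv)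

lemma partial_deriv_const [simp]: "partial_deriv i (\<lambda>y. c) x = 0"
  by (rule partial_deriv_eqI) simp

lemma eventually_line_in_open:
  fixes x v :: "'a::real_normed_vector"
  assumes "open M" and "x \<in> M"
  shows "\<forall>\<^sub>F s in nhds (0::real). x + s *\<^sub>R v \<in> M"
proof -
  have "((\<lambda>s::real. x + s *\<^sub>R v) \<longlongrightarrow> x + 0 *\<^sub>R v) (nhds 0)"
    by (intro tendsto_intros filterlim_ident)
  then show ?thesis
    using topological_tendstoD[of _ x, OF _ assms] by simp
qed

text \<open>Closed forms of the Christoffel symbols hold only on the chart domain. Since a line
  through a point of an open set stays in it for small parameters, they may still be differentiated
  there.\<close>

lemma partial_deriv_cong_open:
  assumes "open M" and "x \<in> M" and "\<And>y. y \<in> M \<Longrightarrow> f y = h y"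
  shows "partial_deriv i f x = partial_deriv i h x"
  unfolding partial_deriv_def
  by (rule deriv_cong_ev)
    (auto intro!: eventually_mono[OF eventually_line_in_open[OF assms(1,2)]] assms(3))

lemma has_real_derivative_shift_0:
  "(f has_real_derivative D) (at (a::real)) \<Longrightarrow> ((\<lambda>s. f (a + s)) has_real_derivative D) (at 0)"
  using DERIV_shift[of f D 0 a] by (simp add: add.commute)

lemma open_vbds_domain:
  assumes "open T"
  shows "open (vbds_domain T)"
proof -
  have "vbds_domain T = (\<lambda>x. x $ 1) -` T \<inter> {x. 0 < x $ 2} \<inter> {x. 0 < x $ 3} \<inter> {x. x $ 3 < pi}
      \<inter> {x. 0 < x $ 4} \<inter> {x. x $ 4 < 2 * pi}"
    by (auto simp: vbds_domain_def)
  moreover have "open ((\<lambda>x::real^4. x $ 1) -` T)"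
    by (intro open_vimage assms continuous_intros)
  ultimately show ?thesis
    by (auto intro!: open_Int open_Collect_less continuous_intros)
qed

section \<open>Compatible tensors in dimension four\<close>

definition compat_sum ::
  "real^'n^'n \<Rightarrow> real^'n^'n \<Rightarrow> ('n::finite \<Rightarrow> 'n \<Rightarrow> 'n \<Rightarrow> 'n \<Rightarrow> real) \<Rightarrow> 'n \<Rightarrow> 'n \<Rightarrow> 'n \<Rightarrow> 'n \<Rightarrow> real"
  where "compat_sum G H D e f s t =
      (\<Sum>d\<in>UNIV. raise_second G H e d * D f s t d)
    + (\<Sum>d\<in>UNIV. raise_second G H f d * D s e t d)
    + (\<Sum>d\<in>UNIV. raise_second G H s d * D e f t d)"

lemma compatible_iff_compat_sum:
  "compatible G H D \<longleftrightarrow> (\<forall>e f s t. compat_sum G H D e f s t = 0)"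
  by (simp add: compatible_def compat_sum_def)

text \<open>The swap reverses the cyclic orientation, so each summand reappears with the first two
  indices of \<open>D\<close> exchanged.\<close>

lemma compat_sum_swap:
  assumes "\<And>f s t d. D f s t d = - D s f t d"
  shows "compat_sum G H D f e s t = - compat_sum G H D e f s t"
proof -
  have "(\<Sum>d\<in>UNIV. raise_second G H a d * D b c t d)
      = - (\<Sum>d\<in>UNIV. raise_second G H a d * D c b t d)" for a b c
    by (subst assms) (simp add: sum_negf)
  from this[of e f s] this[of f s e] this[of s e f] show ?thesis
    by (simp add: compat_sum_def)
qed

text \<open>The sum is cyclic by construction and changes sign under a swap, hence is alternating in
  \<open>e\<close>, \<open>f\<close>, \<open>s\<close>. In dimension four only four index triples
  remain.\<close>

lemma compatible_4_iff:
  fixes G H :: "real^4^4"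
  assumes "\<And>f s t d. D f s t d = - D s f t d"
  shows "compatible G H D \<longleftrightarrow>
    (\<forall>t. compat_sum G H D 1 2 3 t = 0 \<and> compat_sum G H D 1 2 4 t = 0
       \<and> compat_sum G H D 1 3 4 t = 0 \<and> compat_sum G H D 2 3 4 t = 0)"
proof -
  define C where "C = compat_sum G H D"
  have rot: "C e f s t = C f s e t" for e f s t
    by (simp add: C_def compat_sum_def)
  have swap: "C f e s t = - C e f s t" for e f s t
    unfolding C_def by (rule compat_sum_swap[OF assms])
  have "C e e s t = 0" "C e s e t = 0" "C s e e t = 0" for e s t
    using swap[of e e s t] rot[of e e s t] rot[of s e e t] by auto
  then have "(\<forall>e f s. C e f s t = 0) \<longleftrightarrow>
      C 1 2 3 t = 0 \<and> C 1 2 4 t = 0 \<and> C 1 3 4 t = 0 \<and> C 2 3 4 t = 0" for t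
    unfolding forall_4 by (smt (verit) rot swap)
  then show ?thesis
    unfolding compatible_iff_compat_sum C_def by blast
qed

text \<open>The determinant of the system is \<open>r / 2 * (a\<^sup>2 + 2 * c * n)\<close>. It is
  applied with \<open>a\<close>, \<open>c\<close>, \<open>n\<close> equal to \<open>Fr\<close>,
  \<open>Frr\<close>, \<open>1 - F\<close>.\<close>

lemma kernel_trivial_2x2:
  fixes u w :: real
  assumes "a * u = r * c * w" and "n * u + r * a / 2 * w = 0"
    and "a\<^sup>2 + 2 * c * n \<noteq> 0" and "r \<noteq> 0"
  shows "u = 0" and "w = 0"
proof -
  from assms(2) have "2 * n * u + r * a * w = 0"
    by (simp add: field_simps)
  with assms(1) have "(a\<^sup>2 + 2 * c * n) * u = 0" and "r * ((a\<^sup>2 + 2 * c * n) * w) = 0"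
    by algebra+
  then show "u = 0" and "w = 0"
    using assms(3,4) by simp_all
qed

section \<open>Curvature of a radiation metric\<close>

definition radiation_metric :: "(real \<Rightarrow> real \<Rightarrow> real) \<Rightarrow> real^4 \<Rightarrow> real^4^4" where
  "radiation_metric F x =
     vector [vector [F (x$1) (x$2), -1, 0, 0],
             vector [-1, 0, 0, 0],
             vector [0, 0, - (x$2)\<^sup>2, 0],
             vector [0, 0, 0, - ((x$2)\<^sup>2 * (sin (x$3))\<^sup>2)]]"

lemma matrix_inv_radiation_metric:
  assumes "x$2 \<noteq> 0" and "sin (x$3) \<noteq> 0"
  shows "matrix_inv (radiation_metric F x) =
     vector [vector [0, -1, 0, 0],
             vector [-1, - F (x$1) (x$2), 0, 0],
             vector [0, 0, - 1 / (x$2)\<^sup>2, 0],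
             vector [0, 0, 0, - 1 / ((x$2)\<^sup>2 * (sin (x$3))\<^sup>2)]]"
  using assms
  by (intro matrix_inv_eqI)
    (simp_all add: radiation_metric_def vec_eq_iff forall_4 matrix_matrix_mult_def sum_4 mat_def)

text \<open>For distinct \<open>i\<close>, \<open>j\<close> these are the components of dx^i wedge
  dx^j. Products of two of them carry the antisymmetries of the curvature tensor.\<close>

definition bivector :: "'n \<Rightarrow> 'n \<Rightarrow> 'n \<Rightarrow> 'n \<Rightarrow> real" where
  "bivector i j e f = (if e = i \<and> f = j then 1 else if e = j \<and> f = i then -1 else 0)"

text \<open>\<open>Frt\<close> is the derivative of both \<open>Fr\<close> in t and
  \<open>Ft\<close> in r, so equality of mixed partials is built in. No second t-derivative of
  \<open>F\<close> enters the curvature.\<close>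

locale radiation_spacetime =
  fixes T :: "real set" and F Ft Fr Frt Frr :: "real \<Rightarrow> real \<Rightarrow> real"
  assumes open_T: "open T"
    and Ft: "\<And>t r. t \<in> T \<Longrightarrow> r > 0 \<Longrightarrow> ((\<lambda>u. F u r) has_real_derivative Ft t r) (at t)"
    and Fr: "\<And>t r. t \<in> T \<Longrightarrow> r > 0 \<Longrightarrow> (F t has_real_derivative Fr t r) (at r)"
    and Frt: "\<And>t r. t \<in> T \<Longrightarrow> r > 0 \<Longrightarrow> ((\<lambda>u. Fr u r) has_real_derivative Frt t r) (at t)"
    and Ftr: "\<And>t r. t \<in> T \<Longrightarrow> r > 0 \<Longrightarrow> (Ft t has_real_derivative Frt t r) (at r)"
    and Frr: "\<And>t r. t \<in> T \<Longrightarrow> r > 0 \<Longrightarrow> (Fr t has_real_derivative Frr t r) (at r)"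
begin

abbreviation "M \<equiv> vbds_domain T"
abbreviation "g \<equiv> radiation_metric F"

lemma domainD:
  assumes "x \<in> M"
  shows "x$1 \<in> T" "x$2 > 0" "x$2 \<noteq> 0" "sin (x$3) > 0" "sin (x$3) \<noteq> 0"
  using assms sin_gt_zero[of "x$3"] by (auto simp: vbds_domain_def)

lemmas shifted_derivs =
  Ft[THEN has_real_derivative_shift_0] Fr[THEN has_real_derivative_shift_0]
  Frt[THEN has_real_derivative_shift_0] Ftr[THEN has_real_derivative_shift_0]
  Frr[THEN has_real_derivative_shift_0]

section \<open>Metric derivatives and Christoffel symbols\<close>

definition dmetric :: "real^4 \<Rightarrow> real^4^4^4" where
  "dmetric x = vector
     [vector [vector [Ft (x$1) (x$2), 0, 0, 0], 0, 0, 0],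
      vector [vector [Fr (x$1) (x$2), 0, 0, 0], 0, vector [0, 0, - 2 * x$2, 0],
              vector [0, 0, 0, - 2 * x$2 * (sin (x$3))\<^sup>2]],
      vector [0, 0, 0, vector [0, 0, 0, - 2 * (x$2)\<^sup>2 * sin (x$3) * cos (x$3)]],
      0]"

lemma partial_deriv_metric:
  assumes "x \<in> M"
  shows "partial_deriv d (\<lambda>y. g y $ b $ c) x = dmetric x $ d $ b $ c"
proof -
  note [derivative_intros] = shifted_derivs[OF domainD(1,2)[OF assms]]
  have "\<forall>d b c. partial_deriv d (\<lambda>y. g y $ b $ c) x = dmetric x $ d $ b $ c"
    unfolding forall_4 dmetric_def radiation_metric_def
    by (intro conjI; rule partial_deriv_eqI; simp add: axis_def;
        (auto intro!: derivative_eq_intros)?)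
  then show ?thesis by blast
qed

definition christoffel_table :: "real^4 \<Rightarrow> real^4^4^4" where
  "christoffel_table x =
     (let f = F (x$1) (x$2); ft = Ft (x$1) (x$2); fr = Fr (x$1) (x$2);
          r = x$2; s = sin (x$3); c = cos (x$3) in
      vector
       [vector [vector [fr / 2, 0, 0, 0],
                0,
                vector [0, 0, - r, 0],
                vector [0, 0, 0, - r * s\<^sup>2]],
        vector [vector [(f * fr - ft) / 2, - fr / 2, 0, 0],
                vector [- fr / 2, 0, 0, 0],
                vector [0, 0, - f * r, 0],
                vector [0, 0, 0, - f * r * s\<^sup>2]],
        vector [0,
                vector [0, 0, 1 / r, 0],
                vector [0, 1 / r, 0, 0],
                vector [0, 0, 0, - s * c]],
        vector [0,
                vector [0, 0, 0, 1 / r],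
                vector [0, 0, 0, c / s],
                vector [0, 1 / r, c / s, 0]]])"

lemma christoffel_eq:
  assumes "x \<in> M"
  shows "christoffel g a b c x = christoffel_table x $ a $ b $ c"
proof -
  have "\<forall>a b c. christoffel g a b c x = christoffel_table x $ a $ b $ c"
    unfolding christoffel_def partial_deriv_metric[OF assms] sum_4
      matrix_inv_radiation_metric[OF domainD(3,5)[OF assms]]
    using domainD[OF assms]
    by (simp add: forall_4 dmetric_def christoffel_table_def Let_def field_simps power2_eq_square)
  then show ?thesis by blast
qed

text \<open>The \<open>t\<close>-derivative of \<open>\<Gamma>\<close> with indices \<open>2,1,1\<close> would involve second \<open>t\<close>-derivatives of \<open>F\<close>, but
  it cancels from the curvature; its slot holds a dummy \<open>0\<close>.\<close>

definition dchristoffel_table :: "real^4 \<Rightarrow> real^4^4^4^4" where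
  "dchristoffel_table x =
     (let f = F (x$1) (x$2); ft = Ft (x$1) (x$2); fr = Fr (x$1) (x$2);
          frt = Frt (x$1) (x$2); frr = Frr (x$1) (x$2);
          r = x$2; s = sin (x$3); c = cos (x$3) in
      vector
       [vector
         [vector [vector [frt / 2, 0, 0, 0], 0, 0, 0],
          vector [vector [0, - frt / 2, 0, 0],
                  vector [- frt / 2, 0, 0, 0],
                  vector [0, 0, - ft * r, 0],
                  vector [0, 0, 0, - ft * r * s\<^sup>2]],
          0,
          0],
        vector
         [vector [vector [frr / 2, 0, 0, 0],
                  0,
                  vector [0, 0, - 1, 0],
                  vector [0, 0, 0, - s\<^sup>2]],
          vector [vector [(fr\<^sup>2 + f * frr - frt) / 2, - frr / 2, 0, 0],
                  vector [- frr / 2, 0, 0, 0],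
                  vector [0, 0, - (fr * r + f), 0],
                  vector [0, 0, 0, - (fr * r + f) * s\<^sup>2]],
          vector [0,
                  vector [0, 0, - 1 / r\<^sup>2, 0],
                  vector [0, - 1 / r\<^sup>2, 0, 0],
                  0],
          vector [0,
                  vector [0, 0, 0, - 1 / r\<^sup>2],
                  0,
                  vector [0, - 1 / r\<^sup>2, 0, 0]]],
        vector
         [vector [0, 0, 0, vector [0, 0, 0, - 2 * r * s * c]],
          vector [0, 0, 0, vector [0, 0, 0, - 2 * f * r * s * c]],
          vector [0, 0, 0, vector [0, 0, 0, s\<^sup>2 - c\<^sup>2]],
          vector [0,
                  0,
                  vector [0, 0, 0, - 1 / s\<^sup>2],
                  vector [0, 0, - 1 / s\<^sup>2, 0]]],
        0])"

section \<open>Derivatives of the connection, Riemann and Ricci tensors\<close>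

lemma partial_deriv_christoffel:
  assumes x: "x \<in> M" and dabc: "(d, a, b, c) \<noteq> (1, 2, 1, 1)"
  shows "partial_deriv d (christoffel g a b c) x = dchristoffel_table x $ d $ a $ b $ c"
proof -
  note [derivative_intros] = shifted_derivs[OF domainD(1,2)[OF x]]
  note dom = domainD[OF x]
  have "\<forall>a b c d. (d, a, b, c) \<noteq> (1, 2, 1, 1) \<longrightarrow>
      partial_deriv d (\<lambda>y. christoffel_table y $ a $ b $ c) x = dchristoffel_table x $ d $ a $ b $ c"
    unfolding forall_4 christoffel_table_def dchristoffel_table_def Let_def vector_4 zero_index
      partial_deriv_const
    by (intro conjI impI;
        (rule refl | (erule notE, rule refl) | rule partial_deriv_eqI, simp add: axis_def)?;
        (auto intro!: derivative_eq_intros simp: dom)?)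
      (simp_all add: power2_eq_square field_simps cos_squared_eq[unfolded power2_eq_square])
  then show ?thesis
    using partial_deriv_cong_open[OF open_vbds_domain[OF open_T] x christoffel_eq] dabc by simp
qed

text \<open>The dummy slot could be reached only with \<open>s = t = 1\<close>. For
  \<open>s = t\<close> both sides vanish by cancellation, whatever the slot holds; for distinct
  \<open>s\<close>, \<open>t\<close> it is never consulted.\<close>

lemma riemann_eq_christoffel_table:
  assumes "x \<in> M"
  shows "riemann g x e f s t =
    (\<Sum>a\<in>UNIV. g x $ e $ a *
      (dchristoffel_table x $ s $ a $ f $ t - dchristoffel_table x $ t $ a $ f $ s
       + (\<Sum>b\<in>UNIV. christoffel_table x $ b $ f $ t * christoffel_table x $ a $ b $ s)
       - (\<Sum>b\<in>UNIV. christoffel_table x $ b $ f $ s * christoffel_table x $ a $ b $ t)))"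
proof (cases "s = t")
  case False
  then have "partial_deriv s (christoffel g a f t) x = dchristoffel_table x $ s $ a $ f $ t"
    "partial_deriv t (christoffel g a f s) x = dchristoffel_table x $ t $ a $ f $ s" for a
    by (auto intro!: partial_deriv_christoffel[OF assms])
  then show ?thesis
    by (simp add: riemann_def christoffel_eq[OF assms])
qed (simp add: riemann_def)

definition riemann_form :: "real^4 \<Rightarrow> 4 \<Rightarrow> 4 \<Rightarrow> 4 \<Rightarrow> 4 \<Rightarrow> real" where
  "riemann_form x e f s t =
     (let F = F (x$1) (x$2); Ft = Ft (x$1) (x$2); Fr = Fr (x$1) (x$2); Frr = Frr (x$1) (x$2);
          r = x$2; \<sigma> = (sin (x$3))\<^sup>2;
          B = (\<lambda>i j k l. bivector i j e f * bivector k l s t) in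
      - Frr / 2 * B 1 2 1 2
      + r / 2 * (Ft - F * Fr) * (B 1 3 1 3 + \<sigma> * B 1 4 1 4)
      + r * Fr / 2 * (B 1 3 2 3 + B 2 3 1 3 + \<sigma> * (B 1 4 2 4 + B 2 4 1 4))
      - r\<^sup>2 * \<sigma> * (1 - F) * B 3 4 3 4)"

lemma riemann_eq:
  assumes "x \<in> M"
  shows "riemann g x e f s t = riemann_form x e f s t"
proof -
  have "\<forall>e f s t. riemann g x e f s t = riemann_form x e f s t"
    unfolding riemann_eq_christoffel_table[OF assms] sum_4 forall_4
    using domainD(2-5)[OF assms]
    \<comment> \<open>The many zero products are removed first, so that field arithmetic only meets
      short expressions.\<close>
    apply (simp only: christoffel_table_def dchristoffel_table_def radiation_metric_def Let_def
        vector_4 zero_index mult_zero_left mult_zero_right add_0_left add_0_right diff_0_right)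
    by (intro conjI; simp add: riemann_form_def bivector_def Let_def;
        (simp add: field_simps power2_eq_square cos_squared_eq[unfolded power2_eq_square])?)
  then show ?thesis by blast
qed

definition ricci_table :: "real^4 \<Rightarrow> real^4^4" where
  "ricci_table x =
     (let F = F (x$1) (x$2); Ft = Ft (x$1) (x$2); Fr = Fr (x$1) (x$2); Frr = Frr (x$1) (x$2);
          r = x$2; S\<^sub>1\<^sub>2 = Frr / 2 + Fr / r; S\<^sub>3\<^sub>3 = r * Fr + F - 1 in
      vector [vector [Ft / r - F * S\<^sub>1\<^sub>2, S\<^sub>1\<^sub>2, 0, 0],
              vector [S\<^sub>1\<^sub>2, 0, 0, 0],
              vector [0, 0, S\<^sub>3\<^sub>3, 0],
              vector [0, 0, 0, S\<^sub>3\<^sub>3 * (sin (x$3))\<^sup>2]])"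

lemma ricci_eq:
  assumes "x \<in> M"
  shows "ricci g x = ricci_table x"
  using domainD(2-5)[OF assms]
  unfolding vec_eq_iff forall_4 ricci_def riemann_eq[OF assms] sum_4
    matrix_inv_radiation_metric[OF domainD(3,5)[OF assms]]
  by (simp add: riemann_form_def ricci_table_def Let_def bivector_def;
      simp add: field_simps power2_eq_square)

section \<open>The compatibility equations in coordinates\<close>

lemma raise_second_eq:
  assumes "x \<in> M"
  shows "raise_second (g x) H e 1 = - H $ e $ 2"
    and "raise_second (g x) H e 2 = - H $ e $ 1 - F (x$1) (x$2) * H $ e $ 2"
    and "raise_second (g x) H e 3 = - H $ e $ 3 / (x$2)\<^sup>2"
    and "raise_second (g x) H e 4 = - H $ e $ 4 / ((x$2)\<^sup>2 * (sin (x$3))\<^sup>2)"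
  by (simp_all add: raise_second_def sum_4
      matrix_inv_radiation_metric[OF domainD(3,5)[OF assms]])

lemma riemann_antisym:
  assumes "x \<in> M"
  shows "riemann g x e f s t = - riemann g x f e s t"
proof -
  have "bivector i j e f = - bivector i j f e" if "i \<noteq> j" for i j :: 4
    using that by (simp add: bivector_def)
  from this[of 1 2] this[of 1 3] this[of 1 4] this[of 2 3] this[of 2 4] this[of 3 4]
  show ?thesis
    by (simp add: riemann_eq[OF assms] riemann_form_def Let_def field_simps)
qed

text \<open>The components decouple: the (t,r) block, the angular block, the pairs
  \<open>H$2$3\<close>, \<open>H$3$2\<close> and \<open>H$2$4\<close>, \<open>H$4$2\<close>, and,
  once these pairs vanish, \<open>H$1$3\<close>, \<open>H$3$1\<close> and \<open>H$1$4\<close>,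
  \<open>H$4$1\<close>.\<close>

lemma compat_sum_eq:
  fixes H :: "real^4^4"
  assumes x: "x \<in> M"
  defines "C \<equiv> compat_sum (g x) H (riemann g x)"
    and "r \<equiv> x$2" and "f \<equiv> F (x$1) (x$2)" and "ft \<equiv> Ft (x$1) (x$2)"
    and "fr \<equiv> Fr (x$1) (x$2)" and "frr \<equiv> Frr (x$1) (x$2)" and "\<sigma> \<equiv> (sin (x$3))\<^sup>2"
  shows
    "C 1 2 3 1 = ((ft - f * fr) * H$2$3 - fr * H$1$3 + r * frr * (H$3$1 + f * H$3$2)) / (2 * r)"
    "C 1 2 3 2 = (fr * H$2$3 - r * frr * H$3$2) / (2 * r)"
    "C 1 2 3 3 = r / 2 * (fr * (H$1$2 - H$2$1) - ft * H$2$2)"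
    "C 1 2 3 4 = 0"
    "C 1 2 4 1 = ((ft - f * fr) * H$2$4 - fr * H$1$4 + r * frr * (H$4$1 + f * H$4$2)) / (2 * r)"
    "C 1 2 4 2 = (fr * H$2$4 - r * frr * H$4$2) / (2 * r)"
    "C 1 2 4 3 = 0"
    "C 1 2 4 4 = r * \<sigma> / 2 * (fr * (H$1$2 - H$2$1) - ft * H$2$2)"
    "C 1 3 4 1 = (ft - f * fr) * (H$3$4 - H$4$3) / (2 * r)"
    "C 1 3 4 2 = fr * (H$3$4 - H$4$3) / (2 * r)"
    "C 1 3 4 3 = (1 - f) * H$1$4 + r * fr / 2 * H$4$1 + r * ft / 2 * H$4$2"
    "C 1 3 4 4 = - \<sigma> * ((1 - f) * H$1$3 + r * fr / 2 * H$3$1 + r * ft / 2 * H$3$2)"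
    "C 2 3 4 1 = fr * (H$3$4 - H$4$3) / (2 * r)"
    "C 2 3 4 2 = 0"
    "C 2 3 4 3 = (1 - f) * H$2$4 + r * fr / 2 * H$4$2"
    "C 2 3 4 4 = - \<sigma> * ((1 - f) * H$2$3 + r * fr / 2 * H$3$2)"
  using domainD(3)[OF x] power_not_zero[OF domainD(5)[OF x], of 2]
  unfolding C_def compat_sum_def sum_4 riemann_eq[OF x] raise_second_eq[OF x]
  unfolding riemann_form_def Let_def f_def[symmetric] ft_def[symmetric]
    fr_def[symmetric] frr_def[symmetric] \<sigma>_def[symmetric]
  \<comment> \<open>Folded last, because the definitions of \<open>f\<close>, \<open>ft\<close>,
    \<open>fr\<close> and \<open>frr\<close> themselves contain \<open>x$2\<close>.\<close>
  unfolding r_def[symmetric]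
  by (simp_all add: bivector_def) (simp_all add: field_simps power2_eq_square)

lemma compatible_iff:
  assumes "x \<in> M"
  shows "compatible (g x) H (riemann g x) \<longleftrightarrow>
    (\<forall>t. compat_sum (g x) H (riemann g x) 1 2 3 t = 0 \<and> compat_sum (g x) H (riemann g x) 1 2 4 t = 0
       \<and> compat_sum (g x) H (riemann g x) 1 3 4 t = 0 \<and> compat_sum (g x) H (riemann g x) 2 3 4 t = 0)"
  by (intro compatible_4_iff riemann_antisym assms)

lemma compatibleI:
  assumes "x \<in> M"
    and "H$1$3 = 0" "H$1$4 = 0" "H$2$3 = 0" "H$2$4 = 0"
    and "H$3$1 = 0" "H$3$2 = 0" "H$4$1 = 0" "H$4$2 = 0"
    and "H$3$4 = H$4$3"
    and "Fr (x$1) (x$2) * (H$1$2 - H$2$1) = Ft (x$1) (x$2) * H$2$2"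
  shows "compatible (g x) H (riemann g x)"
  unfolding compatible_iff[OF assms(1)] forall_4 compat_sum_eq[OF assms(1)]
  by (simp add: assms)

lemma compatible_blocks:
  assumes x: "x \<in> M" and H: "compatible (g x) H (riemann g x)"
  shows "Fr (x$1) (x$2) * (H$1$2 - H$2$1) = Ft (x$1) (x$2) * H$2$2"
    and "Fr (x$1) (x$2) * (H$3$4 - H$4$3) = 0"
  using H domainD(3,5)[OF x]
  unfolding compatible_iff[OF x] forall_4 compat_sum_eq[OF x] by auto

text \<open>The mixed entries of a compatible tensor solve linear systems whose common determinant is,
  up to a nonzero factor, the quantity assumed nonzero here.\<close>

lemma compatible_off_blocks:
  assumes x: "x \<in> M" and H: "compatible (g x) H (riemann g x)"
    and det: "(Fr (x$1) (x$2))\<^sup>2 + 2 * Frr (x$1) (x$2) * (1 - F (x$1) (x$2)) \<noteq> 0"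
  shows "H$1$3 = 0" "H$1$4 = 0" "H$2$3 = 0" "H$2$4 = 0"
    and "H$3$1 = 0" "H$3$2 = 0" "H$4$1 = 0" "H$4$2 = 0"
proof -
  note r = domainD(3)[OF x]
  note C = H[unfolded compatible_iff[OF x] forall_4 compat_sum_eq[OF x]]
  have "Fr (x$1) (x$2) * H$2$3 = x$2 * Frr (x$1) (x$2) * H$3$2"
    and "(1 - F (x$1) (x$2)) * H$2$3 + x$2 * Fr (x$1) (x$2) / 2 * H$3$2 = 0"
    and "Fr (x$1) (x$2) * H$2$4 = x$2 * Frr (x$1) (x$2) * H$4$2"
    and "(1 - F (x$1) (x$2)) * H$2$4 + x$2 * Fr (x$1) (x$2) / 2 * H$4$2 = 0"
    using C r domainD(5)[OF x] by auto
  note 2 = kernel_trivial_2x2[OF this(1,2) det r] kernel_trivial_2x2[OF this(3,4) det r]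
  then show "H$2$3 = 0" "H$3$2 = 0" "H$2$4 = 0" "H$4$2 = 0" .
  \<comment> \<open>With the mixed entries involving index 2 gone, the terms in \<open>Ft\<close>
    drop out and the same system recurs for index 1.\<close>
  have "Fr (x$1) (x$2) * H$1$3 = x$2 * Frr (x$1) (x$2) * H$3$1"
    and "(1 - F (x$1) (x$2)) * H$1$3 + x$2 * Fr (x$1) (x$2) / 2 * H$3$1 = 0"
    and "Fr (x$1) (x$2) * H$1$4 = x$2 * Frr (x$1) (x$2) * H$4$1"
    and "(1 - F (x$1) (x$2)) * H$1$4 + x$2 * Fr (x$1) (x$2) / 2 * H$4$1 = 0"
    using C r domainD(5)[OF x] by (auto simp: 2)
  from kernel_trivial_2x2[OF this(1,2) det r] kernel_trivial_2x2[OF this(3,4) det r]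
  show "H$1$3 = 0" "H$3$1 = 0" "H$1$4 = 0" "H$4$1 = 0" .
qed

end

section \<open>Rank bounds\<close>

text \<open>If row \<open>j\<close> were a multiple of row \<open>i\<close>, the minor would vanish;
  so the two rows are independent.\<close>

lemma two_le_rankI:
  fixes A :: "real^'n^'m"
  assumes minor: "A$i$k * A$j$l \<noteq> A$i$l * A$j$k"
  shows "2 \<le> rank A"
proof -
  have "A$j \<notin> span {A$i}"
  proof
    assume "A$j \<in> span {A$i}"
    then obtain c where "A$j = c *\<^sub>R A$i" by (auto simp: span_singleton)
    with minor show False by simp
  qed
  moreover from minor have "A$i \<noteq> 0" by auto
  ultimately have "independent {A$j, A$i}" and "card {A$j, A$i} = 2"
    by (auto simp: independent_insert card_insert_if intro: span_base)
  moreover have "{A$j, A$i} \<subseteq> rows A"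
    by (auto simp: rows_def row_def)
  ultimately show ?thesis
    unfolding row_rank_def by (metis independent_card_le_dim)
qed

lemma rank_le_2I:
  fixes A :: "real^4^'m"
  assumes "\<And>i. A$i$3 = 0" and "\<And>i. A$i$4 = 0"
  shows "rank A \<le> 2"
proof -
  have "rows A \<subseteq> span {axis 1 1, axis 2 1}"
  proof
    fix v assume "v \<in> rows A"
    then obtain i where "v = A$i" by (auto simp: rows_def row_def)
    then have "v = v$1 *\<^sub>R axis 1 1 + v$2 *\<^sub>R axis 2 1"
      using assms by (simp add: vec_eq_iff forall_4 axis_def)
    then show "v \<in> span {axis 1 1, axis 2 1}"
      by (metis insertI1 insertI2 singletonI span_add span_base span_scale)
  qed
  then have "rank A \<le> card {axis 1 1, axis 2 1 :: real^4}"
    unfolding row_rank_def by (intro dim_le_card) auto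
  also have "\<dots> \<le> 2" by (simp add: card_insert_if)
  finally show ?thesis .
qed

section \<open>The Vaidya-Bonner-de Sitter case\<close>

definition vbds_F :: "(real \<Rightarrow> real) \<Rightarrow> (real \<Rightarrow> real) \<Rightarrow> real \<Rightarrow> real \<Rightarrow> real \<Rightarrow> real" where
  "vbds_F m q \<Lambda> t r = 1 - 2 * m t / r + (q t)\<^sup>2 / r\<^sup>2 - \<Lambda> * r\<^sup>2 / 3"

definition vbds_Ft :: "(real \<Rightarrow> real) \<Rightarrow> (real \<Rightarrow> real) \<Rightarrow> real \<Rightarrow> real \<Rightarrow> real" where
  "vbds_Ft m q t r = - 2 * deriv m t / r + deriv (\<lambda>s. (q s)\<^sup>2) t / r\<^sup>2"

definition vbds_Fr :: "(real \<Rightarrow> real) \<Rightarrow> (real \<Rightarrow> real) \<Rightarrow> real \<Rightarrow> real \<Rightarrow> real \<Rightarrow> real" where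
  "vbds_Fr m q \<Lambda> t r = 2 * m t / r\<^sup>2 - 2 * (q t)\<^sup>2 / r ^ 3 - 2 * \<Lambda> * r / 3"

definition vbds_Frt :: "(real \<Rightarrow> real) \<Rightarrow> (real \<Rightarrow> real) \<Rightarrow> real \<Rightarrow> real \<Rightarrow> real" where
  "vbds_Frt m q t r = 2 * deriv m t / r\<^sup>2 - 2 * deriv (\<lambda>s. (q s)\<^sup>2) t / r ^ 3"

definition vbds_Frr :: "(real \<Rightarrow> real) \<Rightarrow> (real \<Rightarrow> real) \<Rightarrow> real \<Rightarrow> real \<Rightarrow> real \<Rightarrow> real" where
  "vbds_Frr m q \<Lambda> t r = - 4 * m t / r ^ 3 + 6 * (q t)\<^sup>2 / r ^ 4 - 2 * \<Lambda> / 3"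

lemma vbds_metric_eq: "vbds_metric m q \<Lambda> = radiation_metric (vbds_F m q \<Lambda>)"
  by (simp add: fun_eq_iff vbds_metric_def radiation_metric_def vbds_F_def Let_def)

lemma smooth_real_on_imp_differentiable:
  "smooth_real_on T f \<Longrightarrow> t \<in> T \<Longrightarrow> f differentiable (at t)"
  unfolding smooth_real_on_def by (drule spec[of _ 0]) simp

locale vbds_spacetime =
  fixes T :: "real set" and m q :: "real \<Rightarrow> real" and \<Lambda> :: real
  assumes open_T: "open T"
    and m_diff: "\<And>t. t \<in> T \<Longrightarrow> m differentiable (at t)"
    and q_diff: "\<And>t. t \<in> T \<Longrightarrow> q differentiable (at t)"
    and charged: "\<And>t. t \<in> T \<Longrightarrow> q t \<noteq> 0"

sublocale vbds_spacetime \<subseteq> radiation_spacetime T "vbds_F m q \<Lambda>" "vbds_Ft m q" "vbds_Fr m q \<Lambda>"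
    "vbds_Frt m q" "vbds_Frr m q \<Lambda>"
proof
  fix t r :: real
  assume t: "t \<in> T" and r: "r > 0"
  have [derivative_intros]: "(m has_real_derivative deriv m t) (at t)"
    using m_diff[OF t] by (simp add: DERIV_deriv_iff_real_differentiable)
  \<comment> \<open>Treating the squared charge as one function makes the derivative rules produce
    \<open>deriv w\<close>, matching the derivative of the square in \<open>vbds_Ft\<close>, rather
    than a product with \<open>deriv q\<close>.\<close>
  define w where "w = (\<lambda>s. (q s)\<^sup>2)"
  then have w: "(q s)\<^sup>2 = w s" for s
    by simp
  have [derivative_intros]: "(w has_real_derivative deriv w t) (at t)"
    using q_diff[OF t] by (simp add: DERIV_deriv_iff_real_differentiable w_def)
  show "((\<lambda>u. vbds_F m q \<Lambda> u r) has_real_derivative vbds_Ft m q t r) (at t)"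
    unfolding vbds_F_def vbds_Ft_def w using r
    by (auto intro!: derivative_eq_intros simp: field_simps power2_eq_square)
  show "((\<lambda>u. vbds_Fr m q \<Lambda> u r) has_real_derivative vbds_Frt m q t r) (at t)"
    unfolding vbds_Fr_def vbds_Frt_def w using r
    by (auto intro!: derivative_eq_intros simp: field_simps power2_eq_square power3_eq_cube)
  show "(vbds_F m q \<Lambda> t has_real_derivative vbds_Fr m q \<Lambda> t r) (at r)"
    unfolding vbds_F_def[abs_def] vbds_Fr_def using r
    by (auto intro!: derivative_eq_intros simp: field_simps power2_eq_square power3_eq_cube)
  show "(vbds_Ft m q t has_real_derivative vbds_Frt m q t r) (at r)"
    unfolding vbds_Ft_def[abs_def] vbds_Frt_def using r
    by (auto intro!: derivative_eq_intros simp: field_simps power2_eq_square power3_eq_cube)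
  show "(vbds_Fr m q \<Lambda> t has_real_derivative vbds_Frr m q \<Lambda> t r) (at r)"
    unfolding vbds_Fr_def[abs_def] vbds_Frr_def using r
    by (auto intro!: derivative_eq_intros simp: field_simps power2_eq_square power3_eq_cube power4_eq_xxxx)
qed (rule open_T)

context vbds_spacetime
begin

section \<open>Rank of the Ricci tensor minus a multiple of the metric\<close>

lemma ricci_minus_metric:
  fixes c :: real
  assumes x: "x \<in> M"
  defines "E \<equiv> ricci g x - c *\<^sub>R g x"
    and "r \<equiv> x$2" and "Q \<equiv> (q (x$1))\<^sup>2"
  shows "E$1$2 = Q / r ^ 4 - \<Lambda> + c" and "E$2$1 = Q / r ^ 4 - \<Lambda> + c" and "E$2$2 = 0"
    and "E$3$3 = r\<^sup>2 * (c - \<Lambda> - Q / r ^ 4)"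
    and "E$4$4 = r\<^sup>2 * (sin (x$3))\<^sup>2 * (c - \<Lambda> - Q / r ^ 4)"
    and "E$1$3 = 0" "E$1$4 = 0" "E$2$3 = 0" "E$2$4 = 0" "E$3$4 = 0" "E$4$3 = 0"
  \<comment> \<open>The mass cancels both in \<open>Frr / 2 + Fr / r\<close> and in
    \<open>r * Fr + F - 1\<close>.\<close>
  using domainD(3)[OF x] unfolding E_def r_def Q_def ricci_eq[OF x]
  by (simp_all add: ricci_table_def radiation_metric_def Let_def vbds_F_def vbds_Fr_def vbds_Frr_def)
    (simp_all add: field_simps power2_eq_square power3_eq_cube power4_eq_xxxx)

lemma two_le_rank_ricci_minus_metric:
  assumes x: "x \<in> M"
  shows "2 \<le> rank (ricci g x - c *\<^sub>R g x)"
proof -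
  define P where "P = (q (x$1))\<^sup>2 / (x$2) ^ 4"
  have "P \<noteq> 0"
    using charged domainD(1,3)[OF x] by (simp add: P_def)
  \<comment> \<open>The two quantities differ by \<open>2 * P\<close>. Up to sign, the minors used
    below are the square of the first and a nonzero multiple of the square of the second.\<close>
  then consider "P - \<Lambda> + c \<noteq> 0" | "c - \<Lambda> - P \<noteq> 0" by fastforce
  then show ?thesis
  proof cases
    case 1
    then show ?thesis
      by (intro two_le_rankI[of _ 1 1 2 2]) (simp add: ricci_minus_metric[OF x, folded P_def] del: vector_minus_component vector_scaleR_component)
  next
    case 2
    then show ?thesis using domainD(3,5)[OF x]
      by (intro two_le_rankI[of _ 3 3 4 4]) (simp add: ricci_minus_metric[OF x, folded P_def] del: vector_minus_component vector_scaleR_component)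
  qed
qed

lemma rank_ricci_minus_metric:
  assumes x: "x \<in> M"
  shows "rank (ricci g x - (((x$2) ^ 4 * \<Lambda> + (q (x$1))\<^sup>2) / (x$2) ^ 4) *\<^sub>R g x) = 2"
    (is "rank ?E = 2")
proof (rule antisym)
  have "\<forall>i. ?E$i$3 = 0 \<and> ?E$i$4 = 0"
    unfolding forall_4 ricci_minus_metric[OF x] using domainD(3)[OF x] by (simp add: field_simps)
  then show "rank ?E \<le> 2"
    by (intro rank_le_2I) blast+
qed (rule two_le_rank_ricci_minus_metric[OF x])

section \<open>The general compatible tensor\<close>

lemma Fr_eq_lambda2:
  assumes "x \<in> M"
  shows "vbds_Fr m q \<Lambda> (x$1) (x$2) = - 2 * vbds_lambda2 m q \<Lambda> x / (3 * (x$2) ^ 3)"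
  using domainD(3)[OF assms]
  by (simp add: vbds_Fr_def vbds_lambda2_def Let_def field_simps power2_eq_square power3_eq_cube power4_eq_xxxx)

lemma compatible_vbds_form:
  assumes "x \<in> vbds_regular T m q \<Lambda>"
  shows "compatible (g x) (vbds_compatible_form m q \<Lambda> x h11 h12 h22 h33 h34 h44) (riemann g x)"
proof -
  have x: "x \<in> M" and "vbds_lambda2 m q \<Lambda> x \<noteq> 0"
    using assms by (simp_all add: vbds_regular_def)
  then show ?thesis
    using domainD(3)[OF x]
    by (intro compatibleI)
      (simp_all add: vbds_compatible_form_def Let_def Fr_eq_lambda2 vbds_Ft_def field_simps
        power2_eq_square power3_eq_cube)
qed

text \<open>Multiplied by the sixth power of \<open>r\<close>, the determinant of the off-block systems is a polynomial
  in \<open>r\<close> with constant coefficient a nonzero multiple of the fourth power of the charge.\<close>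

lemma eventually_det_nonzero:
  assumes "t \<in> T" and "r > 0"
  shows "\<forall>\<^sub>F s in at 0. (vbds_Fr m q \<Lambda> t (r + s))\<^sup>2
      + 2 * vbds_Frr m q \<Lambda> t (r + s) * (1 - vbds_F m q \<Lambda> t (r + s)) \<noteq> 0"
proof -
  let ?Q = "(q t)\<^sup>2"
  \<comment> \<open>Constant coefficient first, the factors are \<open>r ^ 3 * Fr\<close>,
    \<open>r ^ 4 * Frr\<close> and \<open>r\<^sup>2 * (1 - F)\<close>; at 0 they give
    \<open>4 * ?Q\<^sup>2 - 12 * ?Q\<^sup>2\<close>.\<close>
  define p where "p = [:- 2 * ?Q, 2 * m t, 0, 0, - 2 * \<Lambda> / 3:]\<^sup>2
    + 2 * [:6 * ?Q, - 4 * m t, 0, 0, - 2 * \<Lambda> / 3:] * [:- ?Q, 2 * m t, 0, 0, \<Lambda> / 3:]"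
  have p: "poly p z = z ^ 6 * ((vbds_Fr m q \<Lambda> t z)\<^sup>2
      + 2 * vbds_Frr m q \<Lambda> t z * (1 - vbds_F m q \<Lambda> t z))" if "z \<noteq> 0" for z
  proof -
    have "poly p z = (z ^ 3 * vbds_Fr m q \<Lambda> t z)\<^sup>2
        + 2 * (z ^ 4 * vbds_Frr m q \<Lambda> t z) * (z\<^sup>2 * (1 - vbds_F m q \<Lambda> t z))"
      using that unfolding p_def vbds_F_def vbds_Fr_def vbds_Frr_def
      by (simp add: field_simps power2_eq_square power3_eq_cube power4_eq_xxxx)
    then show ?thesis by (simp add: algebra_simps flip: power_mult power_add)
  qed
  have "poly p 0 = - 8 * ?Q\<^sup>2"
    by (simp add: p_def power2_eq_square)
  then have "p \<noteq> 0"
    using charged[OF assms(1)] by auto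
  then have "finite {s. poly p (r + s) = 0}"
    using finite_vimageI[OF poly_roots_finite[of p], of "(+) r"] by (simp add: vimage_def)
  then have "\<not> 0 islimpt {s. poly p (r + s) = 0}"
    by (rule islimpt_finite)
  then have "\<forall>\<^sub>F s in at 0. poly p (r + s) \<noteq> 0"
    by (simp add: islimpt_iff_eventually)
  moreover have "\<forall>\<^sub>F s in at 0. r + s \<noteq> 0"
    using assms(2) by (intro tendsto_imp_eventually_ne[of _ r]) (auto intro!: tendsto_eq_intros)
  ultimately show ?thesis
    by eventually_elim (auto simp: p)
qed

lemma eventually_radial_line_regular:
  assumes "x \<in> vbds_regular T m q \<Lambda>"
  shows "\<forall>\<^sub>F s in at 0. x + s *\<^sub>R axis 2 1 \<in> vbds_regular T m q \<Lambda>"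
proof -
  have x: "x \<in> M" and "vbds_lambda2 m q \<Lambda> x \<noteq> 0"
    using assms by (simp_all add: vbds_regular_def)
  moreover have "((\<lambda>s. vbds_lambda2 m q \<Lambda> (x + s *\<^sub>R axis 2 1))
      \<longlongrightarrow> vbds_lambda2 m q \<Lambda> x) (at 0)"
    unfolding vbds_lambda2_def Let_def by (auto intro!: tendsto_eq_intros simp: axis_def)
  ultimately have "\<forall>\<^sub>F s in at 0. vbds_lambda2 m q \<Lambda> (x + s *\<^sub>R axis 2 1) \<noteq> 0"
    by (intro tendsto_imp_eventually_ne)
  moreover have "\<forall>\<^sub>F s in at (0::real). x + s *\<^sub>R axis 2 1 \<in> M"
    using eventually_line_in_open[OF open_vbds_domain[OF open_T] x]
    by (simp add: eventually_nhds_conv_at)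
  ultimately show ?thesis
    by eventually_elim (simp add: vbds_regular_def)
qed

lemma compatible_field_off_blocks:
  assumes cont: "continuous_on (vbds_regular T m q \<Lambda>) H"
    and comp: "\<And>y. y \<in> vbds_regular T m q \<Lambda> \<Longrightarrow> compatible (g y) (H y) (riemann g y)"
    and x: "x \<in> vbds_regular T m q \<Lambda>"
    and ij: "(i, j) \<in> {1, 2} \<times> {3, 4} \<union> {3, 4} \<times> {1, 2}"
  shows "H x $ i $ j = 0"
proof -
  let ?l = "\<lambda>s::real. x + s *\<^sub>R axis 2 1"
  have M: "y \<in> M" if "y \<in> vbds_regular T m q \<Lambda>" for y
    using that by (simp add: vbds_regular_def)
  note reg = eventually_radial_line_regular[OF x]
  have "\<forall>\<^sub>F s in at 0. H (?l s) $ i $ j = 0"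
    using reg eventually_det_nonzero[OF domainD(1,2)[OF M[OF x]]]
  proof eventually_elim
    case (elim s)
    then show ?case
      using compatible_off_blocks[OF M[OF elim(1)] comp[OF elim(1)]] ij by (auto simp: axis_def)
  qed
  \<comment> \<open>The filter \<open>at 0\<close> omits \<open>s = 0\<close>, where the determinant
    may vanish. Continuity identifies this limit with the entry at \<open>x\<close> itself.\<close>
  then have "((\<lambda>s. H (?l s) $ i $ j) \<longlongrightarrow> 0) (at 0)"
    by (rule tendsto_eventually)
  moreover have "(?l \<longlongrightarrow> x + 0 *\<^sub>R axis 2 1) (at 0)"
    by (intro tendsto_intros)
  then have "((\<lambda>s. H (?l s) $ i $ j) \<longlongrightarrow> H x $ i $ j) (at 0)"
    using continuous_on_tendsto_compose[OF cont _ x reg] by (intro tendsto_vec_nth) simp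
  ultimately show ?thesis
    using tendsto_unique trivial_limit_at by blast
qed

lemma compatible_field_eq_vbds_form:
  assumes cont: "continuous_on (vbds_regular T m q \<Lambda>) H"
    and comp: "\<And>y. y \<in> vbds_regular T m q \<Lambda> \<Longrightarrow> compatible (g y) (H y) (riemann g y)"
    and x: "x \<in> vbds_regular T m q \<Lambda>"
  shows "H x = vbds_compatible_form m q \<Lambda> x
    (H x $ 1 $ 1) (H x $ 1 $ 2) (H x $ 2 $ 2) (H x $ 3 $ 3) (H x $ 3 $ 4) (H x $ 4 $ 4)"
proof -
  have M: "x \<in> M" and l: "vbds_lambda2 m q \<Lambda> x \<noteq> 0"
    using x by (simp_all add: vbds_regular_def)
  note r = domainD(3)[OF M]
  note blocks = compatible_blocks[OF M comp[OF x], unfolded Fr_eq_lambda2[OF M]]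
  \<comment> \<open>The (t,r) block relation is divided by \<open>Fr\<close>, which is nonzero
    because \<lambda>2 is.\<close>
  have "H x $ 1 $ 2 - H x $ 2 $ 1 = vbds_Ft m q (x$1) (x$2) * H x $ 2 $ 2
      / (- 2 * vbds_lambda2 m q \<Lambda> x / (3 * (x$2) ^ 3))"
    using blocks(1) l r by (subst nonzero_eq_divide_eq) (simp_all add: mult.commute)
  also have "\<dots> = 3 * x$2 * H x $ 2 $ 2 *
      (2 * x$2 * deriv m (x$1) - deriv (\<lambda>s. (q s)\<^sup>2) (x$1)) / (2 * vbds_lambda2 m q \<Lambda> x)"
    using l r by (simp add: vbds_Ft_def field_simps power2_eq_square power3_eq_cube)
  finally have "H x $ 2 $ 1 = H x $ 1 $ 2 - 3 * x$2 * H x $ 2 $ 2 *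
      (2 * x$2 * deriv m (x$1) - deriv (\<lambda>s. (q s)\<^sup>2) (x$1)) / (2 * vbds_lambda2 m q \<Lambda> x)"
    by linarith
  moreover have "H x $ 4 $ 3 = H x $ 3 $ 4"
    using blocks(2) l r by simp
  ultimately show ?thesis
    using compatible_field_off_blocks[OF cont comp x]
    by (simp add: vec_eq_iff forall_4 vbds_compatible_form_def Let_def)
qed

end

theorem proposition3p1:
  fixes T :: "real set" and m q :: "real \<Rightarrow> real" and \<Lambda> :: real
  assumes T: "open T" "is_interval T" "T \<noteq> {}"
    and m_smooth: "smooth_real_on T m"
    and q_smooth: "smooth_real_on T q"
    and charged: "\<forall>t\<in>T. q t \<noteq> 0"
  shows "\<not> einstein_on (vbds_domain T) (vbds_metric m q \<Lambda>)
    \<and> \<not> quasi_einstein_on (vbds_domain T) (vbds_metric m q \<Lambda>)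
    \<and> two_quasi_einstein_on (vbds_domain T) (vbds_metric m q \<Lambda>)
    \<and> (\<forall>x\<in>vbds_domain T.
         rank (ricci (vbds_metric m q \<Lambda>) x
               - (((x$2)^4 * \<Lambda> + (q (x$1))\<^sup>2) / (x$2)^4) *\<^sub>R vbds_metric m q \<Lambda> x) = 2)
    \<and> (\<forall>h11 h12 h22 h33 h34 h44 :: real^4 \<Rightarrow> real. \<forall>x\<in>vbds_regular T m q \<Lambda>.
         compatible (vbds_metric m q \<Lambda> x)
           (vbds_compatible_form m q \<Lambda> x (h11 x) (h12 x) (h22 x) (h33 x) (h34 x) (h44 x))
           (riemann (vbds_metric m q \<Lambda>) x))
    \<and> (\<forall>H :: real^4 \<Rightarrow> real^4^4.
         continuous_on (vbds_regular T m q \<Lambda>) H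
         \<and> (\<forall>x\<in>vbds_regular T m q \<Lambda>.
              compatible (vbds_metric m q \<Lambda> x) (H x) (riemann (vbds_metric m q \<Lambda>) x))
         \<longrightarrow> (\<exists>h11 h12 h22 h33 h34 h44 :: real^4 \<Rightarrow> real. \<forall>x\<in>vbds_regular T m q \<Lambda>.
               H x = vbds_compatible_form m q \<Lambda> x
                       (h11 x) (h12 x) (h22 x) (h33 x) (h34 x) (h44 x)))"
proof -
  interpret vbds_spacetime T m q \<Lambda>
    using T(1) m_smooth q_smooth charged
    by unfold_locales (auto intro: smooth_real_on_imp_differentiable)
  obtain t where "t \<in> T"
    using T(3) by blast
  then have x: "vector [t, 1, 1, 1] \<in> M" (is "?x \<in> _")
    using pi_gt3 by (simp add: vbds_domain_def)
  \<comment> \<open>One point refutes both conditions: the rank bound is uniform in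
    \<open>c\<close>, so no value of the scalar there can help.\<close>
  have rank: "rank (ricci g ?x - c *\<^sub>R g ?x) \<noteq> 0" "rank (ricci g ?x - c *\<^sub>R g ?x) \<noteq> 1" for c
    using two_le_rank_ricci_minus_metric[OF x, of c] by simp_all
  show ?thesis
    unfolding vbds_metric_eq
  proof (intro conjI ballI allI impI)
    show "\<not> einstein_on M g"
      unfolding einstein_on_def using rank(1) x by blast
    show "\<not> quasi_einstein_on M g"
      unfolding quasi_einstein_on_def using rank(2) x by blast
    show "two_quasi_einstein_on M g"
      unfolding two_quasi_einstein_on_def
      by (intro exI[of _ "\<lambda>x. ((x$2) ^ 4 * \<Lambda> + (q (x$1))\<^sup>2) / (x$2) ^ 4"] ballI
          rank_ricci_minus_metric)
  next
    fix H
    assume H: "continuous_on (vbds_regular T m q \<Lambda>) H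
      \<and> (\<forall>x\<in>vbds_regular T m q \<Lambda>. compatible (g x) (H x) (riemann g x))"
    show "\<exists>h11 h12 h22 h33 h34 h44. \<forall>x\<in>vbds_regular T m q \<Lambda>.
        H x = vbds_compatible_form m q \<Lambda> x (h11 x) (h12 x) (h22 x) (h33 x) (h34 x) (h44 x)"
      by (intro exI ballI, rule compatible_field_eq_vbds_form) (use H in blast)+
  qed (rule rank_ricci_minus_metric compatible_vbds_form; assumption)+
qed

end
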